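(* Let $M$ be an oriented surface in $\mathbb{E}^3$ and let $\gamma: I\subset\mathbb{R}\to M$ be a unit speed curve on $M$ with $(\tau_g(s),\kappa_g(s))\neq(0,0)$ for all $s\in I$. Then $\gamma$ is a relatively normal-slant helix if and only if the function $$\sigma_v(s)=\left(\frac{1}{\left(\kappa_g^2+\tau_g^2\right)^{3/2}}\Big(\tau_g'\kappa_g-\kappa_g'\tau_g-\kappa_n\big(\kappa_g^2+\tau_g^2\big)\Big)\right)(s)$$ is constant.
   Context: $\mathbb{E}^3$ is Euclidean 3-space, $I$ is an interval; surfaces and curves are smooth. For a unit speed curve $\gamma$ on an oriented surface $M\subset\mathbb{E}^3$, the Darboux frame along $\gamma$ is $\{\mathsf{T},\mathsf{V},\mathsf{U}\}$, where $\mathsf{T}=\gamma'$ is the unit tangent vector field, $\mathsf{U}$ is the unit normal vector field of $M$ restricted to $\gamma$, and $\mathsf{V}=\mathsf{U}\times\mathsf{T}$. The geodesic curvature $\kappa_g$, normal curvature $\kappa_n$ and geodesic torsion $\tau_g$ are defined by $$\mathsf{T}'=\kappa_g\mathsf{V}+\kappa_n\mathsf{U},\quad \mathsf{V}'=-\kappa_g\mathsf{T}+\tau_g\mathsf{U},\quad \mathsf{U}'=-\kappa_n\mathsf{T}-\tau_g\mathsf{V}.$$ The curve $\gamma$ is called a relatively normal-slant helix if there exist a fixed unit vector $d$ and a constant angle $\theta$ such that $\langle\mathsf{V}(s),d\rangle=\cos\theta$ for all $s$. *)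

theory Defs
  imports "HOL-Analysis.Analysis"
begin

section \<open>Smooth maps\<close>

fun continuously_differentiable_on ::
    "nat \<Rightarrow> ('a::euclidean_space \<Rightarrow> 'b::euclidean_space) \<Rightarrow> 'a set \<Rightarrow> bool" where
  "continuously_differentiable_on 0 f W \<longleftrightarrow> continuous_on W f"
| "continuously_differentiable_on (Suc k) f W \<longleftrightarrow>
     (\<forall>x\<in>W. f differentiable (at x)) \<and>
     (\<forall>v. continuously_differentiable_on k (\<lambda>x. frechet_derivative f (at x) v) W)"

definition smooth_on_open ::
    "('a::euclidean_space \<Rightarrow> 'b::euclidean_space) \<Rightarrow> 'a set \<Rightarrow> bool" where
  "smooth_on_open f W \<longleftrightarrow> open W \<and> (\<forall>k. continuously_differentiable_on k f W)"

text \<open>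
  On an arbitrary subset of a Euclidean space (an interval that may contain its endpoints,
  a surface), a map is smooth if it extends, near each point, to a smooth map on an open set.
\<close>

definition smooth_map_on ::
    "('a::euclidean_space \<Rightarrow> 'b::euclidean_space) \<Rightarrow> 'a set \<Rightarrow> bool" where
  "smooth_map_on f X \<longleftrightarrow>
     (\<forall>x\<in>X. \<exists>W g. x \<in> W \<and> smooth_on_open g W \<and> (\<forall>y\<in>W \<inter> X. g y = f y))"


section \<open>Oriented surfaces in Euclidean 3-space\<close>

definition regular_surface :: "(real^3) set \<Rightarrow> bool" where
  "regular_surface M \<longleftrightarrow>
     (\<forall>p\<in>M. \<exists>(W::(real^3) set) (D::(real^2) set) x y.
        open W \<and> p \<in> W \<and> smooth_on_open x D \<and> homeomorphism D (M \<inter> W) x y \<and>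
        (\<forall>q\<in>D. inj (frechet_derivative x (at q))))"

definition tangent_plane :: "(real^3) set \<Rightarrow> real^3 \<Rightarrow> (real^3) set" where
  "tangent_plane M p =
     {w. \<exists>\<alpha> a b t. t \<in> {a<..<b} \<and> smooth_on_open \<alpha> {a<..<b} \<and> \<alpha> ` {a<..<b} \<subseteq> M \<and>
                   \<alpha> t = p \<and> (\<alpha> has_vector_derivative w) (at t)}"

text \<open>An orientation of \<open>M\<close> is given by a smooth unit normal vector field \<open>N\<close>.\<close>

definition oriented_surface :: "(real^3) set \<Rightarrow> (real^3 \<Rightarrow> real^3) \<Rightarrow> bool" where
  "oriented_surface M N \<longleftrightarrow>
     regular_surface M \<and> smooth_map_on N M \<and>
     (\<forall>p\<in>M. norm (N p) = 1 \<and> (\<forall>w\<in>tangent_plane M p. N p \<bullet> w = 0))"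


section \<open>Curves on a surface and their Darboux frame\<close>

text \<open>
  All derivatives along a curve are taken within the parameter interval \<open>I\<close>; they are
  the ordinary ones at interior points and one-sided ones at endpoints belonging to \<open>I\<close>.
\<close>

definition deriv_on :: "real set \<Rightarrow> (real \<Rightarrow> 'a::real_normed_vector) \<Rightarrow> real \<Rightarrow> 'a" where
  "deriv_on I f s = vector_derivative f (at s within I)"

definition unit_speed_curve_on :: "(real^3) set \<Rightarrow> real set \<Rightarrow> (real \<Rightarrow> real^3) \<Rightarrow> bool" where
  "unit_speed_curve_on M I \<gamma> \<longleftrightarrow>
     smooth_map_on \<gamma> I \<and> \<gamma> ` I \<subseteq> M \<and> (\<forall>s\<in>I. norm (deriv_on I \<gamma> s) = 1)"

definition darboux_T :: "real set \<Rightarrow> (real \<Rightarrow> real^3) \<Rightarrow> real \<Rightarrow> real^3" where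
  "darboux_T I \<gamma> = deriv_on I \<gamma>"

definition darboux_U :: "(real^3 \<Rightarrow> real^3) \<Rightarrow> (real \<Rightarrow> real^3) \<Rightarrow> real \<Rightarrow> real^3" where
  "darboux_U N \<gamma> s = N (\<gamma> s)"

definition darboux_V ::
    "(real^3 \<Rightarrow> real^3) \<Rightarrow> real set \<Rightarrow> (real \<Rightarrow> real^3) \<Rightarrow> real \<Rightarrow> real^3" where
  "darboux_V N I \<gamma> s = cross3 (darboux_U N \<gamma> s) (darboux_T I \<gamma> s)"

text \<open>
  The curvatures are the coefficients of \<open>T'\<close> and \<open>V'\<close> in the orthonormal frame \<open>T, V, U\<close>;
  the theorem \<open>darboux_equations\<close> below shows that they satisfy the Darboux frame equations,
  and \<open>darboux_equations_unique\<close> that these equations determine them.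
\<close>

definition geodesic_curvature ::
    "(real^3 \<Rightarrow> real^3) \<Rightarrow> real set \<Rightarrow> (real \<Rightarrow> real^3) \<Rightarrow> real \<Rightarrow> real" where
  "geodesic_curvature N I \<gamma> s = deriv_on I (darboux_T I \<gamma>) s \<bullet> darboux_V N I \<gamma> s"

definition normal_curvature ::
    "(real^3 \<Rightarrow> real^3) \<Rightarrow> real set \<Rightarrow> (real \<Rightarrow> real^3) \<Rightarrow> real \<Rightarrow> real" where
  "normal_curvature N I \<gamma> s = deriv_on I (darboux_T I \<gamma>) s \<bullet> darboux_U N \<gamma> s"

definition geodesic_torsion ::
    "(real^3 \<Rightarrow> real^3) \<Rightarrow> real set \<Rightarrow> (real \<Rightarrow> real^3) \<Rightarrow> real \<Rightarrow> real" where
  "geodesic_torsion N I \<gamma> s = deriv_on I (darboux_V N I \<gamma>) s \<bullet> darboux_U N \<gamma> s"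

definition relatively_normal_slant_helix ::
    "(real^3 \<Rightarrow> real^3) \<Rightarrow> real set \<Rightarrow> (real \<Rightarrow> real^3) \<Rightarrow> bool" where
  "relatively_normal_slant_helix N I \<gamma> \<longleftrightarrow>
     (\<exists>d \<theta>. norm d = 1 \<and> (\<forall>s\<in>I. darboux_V N I \<gamma> s \<bullet> d = cos \<theta>))"

definition sigma_v ::
    "(real^3 \<Rightarrow> real^3) \<Rightarrow> real set \<Rightarrow> (real \<Rightarrow> real^3) \<Rightarrow> real \<Rightarrow> real" where
  "sigma_v N I \<gamma> s =
     (let \<kappa>g = geodesic_curvature N I \<gamma>; \<kappa>n = normal_curvature N I \<gamma>;
          \<tau>g = geodesic_torsion N I \<gamma>
      in 1 / ((\<kappa>g s)\<^sup>2 + (\<tau>g s)\<^sup>2) powr (3/2) *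
         (deriv_on I \<tau>g s * \<kappa>g s - deriv_on I \<kappa>g s * \<tau>g s - \<kappa>n s * ((\<kappa>g s)\<^sup>2 + (\<tau>g s)\<^sup>2)))"


section \<open>The Darboux frame equations\<close>

lemma smooth_on_open_differentiable:
  "smooth_on_open f W \<Longrightarrow> x \<in> W \<Longrightarrow> f differentiable (at x)"
  unfolding smooth_on_open_def using continuously_differentiable_on.simps(2)[of 0 f W] by blast

lemma smooth_on_open_frechet_derivative:
  "smooth_on_open f W \<Longrightarrow> smooth_on_open (\<lambda>x. frechet_derivative f (at x) v) W"
  unfolding smooth_on_open_def using continuously_differentiable_on.simps(2)[of _ f W] by blast

lemma at_within_interval_nontrivial:
  fixes I :: "real set"
  assumes "is_interval I" "interior I \<noteq> {}" "s \<in> I"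
  shows "at s within I \<noteq> bot"
proof -
  have "I \<noteq> {t}" for t
    using assms(2) by auto
  then have "s islimpt I"
    using connected_imp_perfect[of I s] assms is_interval_connected by blast
  then show ?thesis
    by (simp add: trivial_limit_within)
qed

lemma deriv_on_eq:
  assumes "is_interval I" "interior I \<noteq> {}" "s \<in> I"
    and "(f has_vector_derivative f') (at s within I)"
  shows "deriv_on I f s = f'"
  unfolding deriv_on_def
  using vector_derivative_within at_within_interval_nontrivial assms by blast

lemma has_vector_derivative_local:
  assumes "smooth_on_open g W" "s \<in> W" "s \<in> I" "\<And>y. y \<in> W \<inter> I \<Longrightarrow> g y = f y"
  shows "(f has_vector_derivative frechet_derivative g (at s) 1) (at s within I)"
proof -
  have "(g has_derivative frechet_derivative g (at s)) (at s)"
    using smooth_on_open_differentiable[OF assms(1,2)] frechet_derivative_works by blast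
  moreover from this have "frechet_derivative g (at s) x = x *\<^sub>R frechet_derivative g (at s) 1" for x
    using linear_scale[OF has_derivative_linear, of g _ "at s" x 1] by simp
  then have "frechet_derivative g (at s) = (\<lambda>x. x *\<^sub>R frechet_derivative g (at s) 1)"
    by (rule ext)
  ultimately have "(g has_vector_derivative frechet_derivative g (at s) 1) (at s within I)"
    unfolding has_vector_derivative_def by (metis has_derivative_at_withinI)
  moreover have "eventually (\<lambda>y. g y = f y) (at s within I)"
    unfolding eventually_at_topological
    using assms(1,2,4) by (intro exI[of _ W]) (auto simp: smooth_on_open_def)
  ultimately show ?thesis
    using assms(2-4) unfolding has_vector_derivative_def
    by (intro has_derivative_transform_eventually[of g _ s I f]) auto
qed

lemma smooth_map_on_has_vector_derivative:
  assumes "is_interval I" "interior I \<noteq> {}" "smooth_map_on f I" "s \<in> I"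
  shows "(f has_vector_derivative deriv_on I f s) (at s within I)"
proof -
  obtain W g where W: "s \<in> W" "smooth_on_open g W" "\<And>y. y \<in> W \<inter> I \<Longrightarrow> g y = f y"
    using assms(3,4) unfolding smooth_map_on_def by meson
  have "(f has_vector_derivative frechet_derivative g (at s) 1) (at s within I)"
    by (rule has_vector_derivative_local[OF W(2,1) assms(4) W(3)])
  with deriv_on_eq[OF assms(1,2,4)] show ?thesis
    by metis
qed

lemma smooth_map_on_deriv_on:
  assumes "is_interval I" "interior I \<noteq> {}" "smooth_map_on f I"
  shows "smooth_map_on (deriv_on I f) I"
  unfolding smooth_map_on_def
proof
  fix s assume "s \<in> I"
  then obtain W g where W: "s \<in> W" "smooth_on_open g W" "\<And>y. y \<in> W \<inter> I \<Longrightarrow> g y = f y"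
    using assms(3) unfolding smooth_map_on_def by meson
  have "frechet_derivative g (at y) 1 = deriv_on I f y" if "y \<in> W \<inter> I" for y
    using that deriv_on_eq[OF assms(1,2), of y f] has_vector_derivative_local[OF W(2) _ _ W(3), of y I]
    by auto
  then show "\<exists>W g. s \<in> W \<and> smooth_on_open g W \<and> (\<forall>y\<in>W \<inter> I. g y = deriv_on I f y)"
    using W(1) smooth_on_open_frechet_derivative[OF W(2)] by blast
qed

lemma compose_has_vector_derivative:
  assumes "is_interval I" "interior I \<noteq> {}" "smooth_map_on \<gamma> I" "\<gamma> ` I \<subseteq> M"
    and "smooth_map_on N M" "s \<in> I"
  shows "((\<lambda>t. N (\<gamma> t)) has_vector_derivative deriv_on I (\<lambda>t. N (\<gamma> t)) s) (at s within I)"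
proof -
  have g: "(\<gamma> has_vector_derivative deriv_on I \<gamma> s) (at s within I)"
    by (rule smooth_map_on_has_vector_derivative[OF assms(1-3,6)])
  have "\<gamma> s \<in> M"
    using assms(4,6) by auto
  then obtain W h where W: "\<gamma> s \<in> W" "smooth_on_open h W" "\<And>y. y \<in> W \<inter> M \<Longrightarrow> h y = N y"
    using assms(5) unfolding smooth_map_on_def by meson
  have "(h has_derivative frechet_derivative h (at (\<gamma> s))) (at (\<gamma> s))"
    using smooth_on_open_differentiable[OF W(2,1)] frechet_derivative_works by blast
  from vector_derivative_diff_chain_within[OF g has_derivative_at_withinI[OF this]]
  have h: "((h \<circ> \<gamma>) has_vector_derivative frechet_derivative h (at (\<gamma> s)) (deriv_on I \<gamma> s)) (at s within I)" .
  have "(\<gamma> \<longlongrightarrow> \<gamma> s) (at s within I)"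
    using has_vector_derivative_continuous[OF g] by (simp add: continuous_within)
  then have "eventually (\<lambda>t. \<gamma> t \<in> W) (at s within I)"
    using W(1,2) topological_tendstoD unfolding smooth_on_open_def by blast
  moreover have "eventually (\<lambda>t. t \<in> I) (at s within I)"
    by (simp add: eventually_at_filter)
  ultimately have ev: "eventually (\<lambda>t. (h \<circ> \<gamma>) t = N (\<gamma> t)) (at s within I)"
    by eventually_elim (use W(3) assms(4) in auto)
  have "(h \<circ> \<gamma>) s = N (\<gamma> s)"
    using W(1,3) \<open>\<gamma> s \<in> M\<close> by simp
  then have d: "((\<lambda>t. N (\<gamma> t)) has_vector_derivative
      frechet_derivative h (at (\<gamma> s)) (deriv_on I \<gamma> s)) (at s within I)"
    using assms(6) unfolding has_vector_derivative_def
    by (rule has_derivative_transform_eventually[OF h[unfolded has_vector_derivative_def] ev])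
  show ?thesis
    using d deriv_on_eq[OF assms(1,2,6) d] by simp
qed

lemma inner_deriv_on_eq_0:
  assumes "is_interval I" "interior I \<noteq> {}" "s \<in> I"
    and "(f has_vector_derivative f') (at s within I)"
    and "(g has_vector_derivative g') (at s within I)"
    and "\<And>t. t \<in> I \<Longrightarrow> f t \<bullet> g t = c"
  shows "f s \<bullet> g' + f' \<bullet> g s = 0"
proof -
  have "((\<lambda>t. f t \<bullet> g t) has_vector_derivative f s \<bullet> g' + f' \<bullet> g s) (at s within I)"
    by (rule bounded_bilinear.has_vector_derivative[OF bounded_bilinear_inner assms(4,5)])
  moreover have "((\<lambda>t. f t \<bullet> g t) has_vector_derivative 0) (at s within I)"
    by (rule has_vector_derivative_transform[OF assms(3) _ has_vector_derivative_const[of c]])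
       (use assms(6) in auto)
  ultimately show ?thesis
    using vector_derivative_unique_within[OF at_within_interval_nontrivial[OF assms(1-3)]] by blast
qed

lemma orthonormal_cross_expansion:
  fixes t u x :: "real^3"
  assumes "norm t = 1" "norm u = 1" "u \<bullet> t = 0"
  defines "v \<equiv> cross3 u t"
  shows "norm v = 1" "v \<bullet> t = 0" "v \<bullet> u = 0"
    and "x = (x \<bullet> t) *\<^sub>R t + (x \<bullet> v) *\<^sub>R v + (x \<bullet> u) *\<^sub>R u"
proof -
  show v: "v \<bullet> t = 0" "v \<bullet> u = 0"
    unfolding v_def by (simp_all add: dot_cross_self)
  have "(norm v)\<^sup>2 = 1"
    using norm_cross_dot[of u t] assms by simp
  then show n: "norm v = 1"
    by (simp add: power2_eq_1_iff) (smt (verit) norm_ge_zero)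
  have sq: "t \<bullet> t = 1" "u \<bullet> u = 1" "v \<bullet> v = 1"
    using assms n by (simp_all add: dot_square_norm)
  let ?B = "{t, v, u}"
  have ne: "t \<noteq> v" "t \<noteq> u" "v \<noteq> u" "t \<noteq> 0" "u \<noteq> 0" "v \<noteq> 0"
    using sq v assms(3) by auto
  have po: "pairwise orthogonal ?B"
    using v assms(3) by (auto simp: pairwise_def orthogonal_def inner_commute)
  then have ind: "independent ?B"
    using pairwise_orthogonal_independent ne by blast
  have "dim (UNIV :: (real^3) set) = card ?B"
    using ne by simp
  then have "span ?B = UNIV"
    using card_ge_dim_independent[OF subset_UNIV ind] by auto
  then have "x \<in> span ?B" by simp
  then obtain a b c where x: "x = a *\<^sub>R t + b *\<^sub>R v + c *\<^sub>R u"
    unfolding span_breakdown_eq span_empty by (auto simp: algebra_simps)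
  have "x \<bullet> t = a" "x \<bullet> v = b" "x \<bullet> u = c"
    using sq v assms(3) unfolding x by (simp_all add: inner_add_left inner_add_right inner_commute)
  then show "x = (x \<bullet> t) *\<^sub>R t + (x \<bullet> v) *\<^sub>R v + (x \<bullet> u) *\<^sub>R u"
    using x by simp
qed

context
  fixes M :: "(real^3) set" and N :: "real^3 \<Rightarrow> real^3"
    and I :: "real set" and \<gamma> :: "real \<Rightarrow> real^3"
  assumes M: "oriented_surface M N"
    and I: "is_interval I" "interior I \<noteq> {}"
    and \<gamma>: "unit_speed_curve_on M I \<gamma>"
begin

lemma darboux_has_vector_derivative:
  assumes "s \<in> I"
  shows "(darboux_T I \<gamma> has_vector_derivative deriv_on I (darboux_T I \<gamma>) s) (at s within I)"
    and "(darboux_U N \<gamma> has_vector_derivative deriv_on I (darboux_U N \<gamma>) s) (at s within I)"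
    and "(darboux_V N I \<gamma> has_vector_derivative deriv_on I (darboux_V N I \<gamma>) s) (at s within I)"
proof -
  show T: "(darboux_T I \<gamma> has_vector_derivative deriv_on I (darboux_T I \<gamma>) s) (at s within I)"
    unfolding darboux_T_def using \<gamma> I assms unfolding unit_speed_curve_on_def
    by (intro smooth_map_on_has_vector_derivative smooth_map_on_deriv_on) auto
  have "darboux_U N \<gamma> = (\<lambda>t. N (\<gamma> t))"
    by (auto simp: darboux_U_def)
  then show U: "(darboux_U N \<gamma> has_vector_derivative deriv_on I (darboux_U N \<gamma>) s) (at s within I)"
    using compose_has_vector_derivative[OF I, of \<gamma> M N s] \<gamma> M assms
    unfolding unit_speed_curve_on_def oriented_surface_def by auto
  have "darboux_V N I \<gamma> = (\<lambda>t. cross3 (darboux_U N \<gamma> t) (darboux_T I \<gamma> t))"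
    by (auto simp: darboux_V_def)
  moreover have "bounded_bilinear cross3"
    using bilinear_cross bilinear_conv_bounded_bilinear by blast
  ultimately obtain D where D: "(darboux_V N I \<gamma> has_vector_derivative D) (at s within I)"
    using bounded_bilinear.has_vector_derivative[OF _ U T, of cross3] by auto
  then show "(darboux_V N I \<gamma> has_vector_derivative deriv_on I (darboux_V N I \<gamma>) s) (at s within I)"
    using deriv_on_eq[OF I assms D] by simp
qed

lemma darboux_orthonormal:
  assumes "s \<in> I"
  shows "norm (darboux_T I \<gamma> s) = 1" "norm (darboux_U N \<gamma> s) = 1"
    "darboux_U N \<gamma> s \<bullet> darboux_T I \<gamma> s = 0"
proof -
  show "norm (darboux_T I \<gamma> s) = 1" "norm (darboux_U N \<gamma> s) = 1"
    using \<gamma> M assms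
    by (auto simp: unit_speed_curve_on_def oriented_surface_def darboux_T_def darboux_U_def)
  have sm: "smooth_map_on \<gamma> I" and sub: "\<gamma> ` I \<subseteq> M"
    using \<gamma> by (auto simp: unit_speed_curve_on_def)
  let ?h = "\<lambda>t. darboux_U N \<gamma> t \<bullet> darboux_T I \<gamma> t"
  have int: "?h t = 0" if "t \<in> interior I" for t
  proof -
    have tI: "t \<in> I" using that interior_subset by auto
    obtain W g where W: "t \<in> W" "smooth_on_open g W" "\<And>y. y \<in> W \<inter> I \<Longrightarrow> g y = \<gamma> y"
      using sm tI unfolding smooth_map_on_def by meson
    have "open (W \<inter> interior I)" "t \<in> W \<inter> interior I"
      using W(1,2) that by (auto simp: smooth_on_open_def)
    then obtain e where e: "e > 0" "ball t e \<subseteq> W \<inter> interior I"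
      using open_contains_ball by metis
    define a b where "a = t - e" and "b = t + e"
    have ab: "{a<..<b} \<subseteq> W" "{a<..<b} \<subseteq> I" "t \<in> {a<..<b}"
      using e interior_subset by (auto simp: a_def b_def ball_eq_greaterThanLessThan)
    have mono: "continuously_differentiable_on k f {a<..<b}"
      if "continuously_differentiable_on k f W" for k and f :: "real \<Rightarrow> real^3"
      using that ab(1) by (induction k arbitrary: f) (auto intro: continuous_on_subset)
    have "smooth_on_open g {a<..<b}"
      using W(2) mono by (auto simp: smooth_on_open_def)
    moreover have "g ` {a<..<b} \<subseteq> M"
      using sub ab W(3) by (smt (verit) IntI image_subset_iff subsetD)
    moreover have "(g has_vector_derivative darboux_T I \<gamma> t) (at t)"
    proof -
      have "(\<gamma> has_vector_derivative darboux_T I \<gamma> t) (at t within I)"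
        unfolding darboux_T_def by (rule smooth_map_on_has_vector_derivative[OF I sm tI])
      then have "(\<gamma> has_vector_derivative darboux_T I \<gamma> t) (at t within {a<..<b})"
        using ab(2) has_vector_derivative_within_subset by blast
      then have "(g has_vector_derivative darboux_T I \<gamma> t) (at t within {a<..<b})"
        by (rule has_vector_derivative_transform[OF ab(3), rotated]) (use ab W(3) in blast)
      then show ?thesis
        using at_within_open[OF ab(3)] by simp
    qed
    ultimately have "darboux_T I \<gamma> t \<in> tangent_plane M (\<gamma> t)"
      unfolding tangent_plane_def using ab(3) W(1,3) tI by blast
    then show ?thesis
      using M sub tI by (auto simp: oriented_surface_def darboux_U_def)
  qed
  have "continuous_on I ?h"
    unfolding continuous_on_eq_continuous_within
    by (intro ballI continuous_inner)
       (blast intro: has_vector_derivative_continuous darboux_has_vector_derivative)+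
  then obtain C where C: "closed C" "{x \<in> I. ?h x = 0} = I \<inter> C"
    using continuous_closedin_preimage_constant[of I ?h 0] unfolding closedin_closed by auto
  have "interior I \<subseteq> C"
    using int C(2) interior_subset[of I] by blast
  then have "closure (interior I) \<subseteq> C"
    using C(1) by (rule closure_minimal)
  moreover have "I \<subseteq> closure (interior I)"
    using convex_closure_interior[of I] I is_interval_convex closure_subset by blast
  ultimately show "?h s = 0"
    using C(2) assms by blast
qed

theorem darboux_equations:
  assumes "s \<in> I"
  defines "T \<equiv> darboux_T I \<gamma>" and "V \<equiv> darboux_V N I \<gamma>" and "U \<equiv> darboux_U N \<gamma>"
    and "\<kappa>g \<equiv> geodesic_curvature N I \<gamma> s" and "\<kappa>n \<equiv> normal_curvature N I \<gamma> s"
    and "\<tau>g \<equiv> geodesic_torsion N I \<gamma> s"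
  shows "deriv_on I T s = \<kappa>g *\<^sub>R V s + \<kappa>n *\<^sub>R U s"
    and "deriv_on I V s = - \<kappa>g *\<^sub>R T s + \<tau>g *\<^sub>R U s"
    and "deriv_on I U s = - \<kappa>n *\<^sub>R T s - \<tau>g *\<^sub>R V s"
proof -
  have V: "V t = cross3 (U t) (T t)" for t
    by (simp add: V_def U_def T_def darboux_V_def)
  note on = darboux_orthonormal[folded T_def U_def]
  note fr = orthonormal_cross_expansion[OF on, folded V]
  note d = darboux_has_vector_derivative[OF assms(1), folded T_def U_def V_def]
  note z = inner_deriv_on_eq_0[OF I assms(1)]
  have TT: "deriv_on I T s \<bullet> T s = 0"
    using z[OF d(1) d(1), of 1] on(1) by (simp add: dot_square_norm inner_commute)
  have UU: "deriv_on I U s \<bullet> U s = 0"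
    using z[OF d(2) d(2), of 1] on(2) by (simp add: dot_square_norm inner_commute)
  have VV: "deriv_on I V s \<bullet> V s = 0"
    using z[OF d(3) d(3), of 1] fr(1) by (simp add: dot_square_norm inner_commute)
  have VT: "deriv_on I V s \<bullet> T s = - \<kappa>g"
    using z[OF d(3) d(1), of 0] fr(2)
    by (simp add: \<kappa>g_def geodesic_curvature_def T_def V_def inner_commute)
  have UT: "deriv_on I U s \<bullet> T s = - \<kappa>n"
    using z[OF d(2) d(1), of 0] on(3)
    by (simp add: \<kappa>n_def normal_curvature_def T_def U_def inner_commute)
  have UV: "deriv_on I U s \<bullet> V s = - \<tau>g"
    using z[OF d(3) d(2), of 0] fr(3)
    by (simp add: \<tau>g_def geodesic_torsion_def V_def U_def inner_commute)
  show "deriv_on I T s = \<kappa>g *\<^sub>R V s + \<kappa>n *\<^sub>R U s"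
    using fr(4)[OF assms(1) assms(1) assms(1), of "deriv_on I T s"] TT
    by (simp add: \<kappa>g_def \<kappa>n_def geodesic_curvature_def normal_curvature_def T_def U_def V_def)
  show "deriv_on I V s = - \<kappa>g *\<^sub>R T s + \<tau>g *\<^sub>R U s"
    using fr(4)[OF assms(1) assms(1) assms(1), of "deriv_on I V s"] VV VT
    by (simp add: \<tau>g_def geodesic_torsion_def U_def V_def)
  show "deriv_on I U s = - \<kappa>n *\<^sub>R T s - \<tau>g *\<^sub>R V s"
    using fr(4)[OF assms(1) assms(1) assms(1), of "deriv_on I U s"] UU UT UV
    by simp
qed

theorem darboux_equations_unique:
  assumes "s \<in> I"
    and "deriv_on I (darboux_T I \<gamma>) s = a *\<^sub>R darboux_V N I \<gamma> s + b *\<^sub>R darboux_U N \<gamma> s"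
    and "deriv_on I (darboux_V N I \<gamma>) s = - a *\<^sub>R darboux_T I \<gamma> s + c *\<^sub>R darboux_U N \<gamma> s"
  shows "a = geodesic_curvature N I \<gamma> s" "b = normal_curvature N I \<gamma> s"
    "c = geodesic_torsion N I \<gamma> s"
proof -
  note on = darboux_orthonormal[OF assms(1)]
  note fr = orthonormal_cross_expansion(1-3)[OF on, folded darboux_V_def]
  show "a = geodesic_curvature N I \<gamma> s" "b = normal_curvature N I \<gamma> s"
    "c = geodesic_torsion N I \<gamma> s"
    using on fr unfolding geodesic_curvature_def normal_curvature_def geodesic_torsion_def assms(2,3)
    by (simp_all add: inner_add_left inner_add_right inner_diff_left inner_diff_right
          dot_square_norm inner_commute)
qed

end

end

theory Submission
  imports Defs
begin

text \<open>
  Put \<open>\<rho> = sqrt (\<kappa>g\<^sup>2 + \<tau>g\<^sup>2)\<close>, which vanishes nowhere by hypothesis. Since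
  \<open>V' = -\<kappa>g T + \<tau>g U\<close> has length \<open>\<rho>\<close>, the vectors \<open>P = V' / \<rho>\<close> and
  \<open>W = (\<tau>g T + \<kappa>g U) / \<rho>\<close> complete \<open>V\<close> to an orthonormal frame. The Darboux frame
  equations turn into
  \<open>V' = \<rho> P\<close>, \<open>P' = \<rho> (\<sigma> W - V)\<close>, \<open>W' = -\<rho> \<sigma> P\<close>,
  where \<open>\<sigma>\<close> is exactly the function \<open>sigma_v\<close>: the pair \<open>(\<kappa>g, \<tau>g) / \<rho>\<close> is a point of
  the unit circle that turns with angular velocity
  \<open>\<omega> = (\<tau>g' \<kappa>g - \<kappa>g' \<tau>g) / \<rho>\<^sup>2\<close>, the frame \<open>T, U\<close> itself turns with velocity
  \<open>\<kappa>n\<close>, and \<open>\<rho> \<sigma> = \<omega> - \<kappa>n\<close> is the difference. So \<open>V, P, W\<close> is the Frenet frame of a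
  curve with tangent \<open>V\<close>, curvature \<open>\<rho>\<close> and torsion \<open>\<rho> \<sigma>\<close>, and the claim is Lancret's
  theorem (\<open>lancret_frame\<close>): the tangent makes a constant angle with a fixed direction iff
  the ratio of torsion to curvature is constant. Differentiating \<open>V \<bullet> d = c\<close> twice gives
  \<open>P \<bullet> d = 0\<close> and \<open>\<sigma> (W \<bullet> d) = c\<close> with \<open>W \<bullet> d\<close> constant; conversely, for constant
  \<open>\<sigma>\<close> the vector \<open>\<sigma> V + W\<close> is constant and spans the axis.

  The formula for \<open>\<sigma>\<close> involves the derivatives of \<open>\<kappa>g\<close> and \<open>\<tau>g\<close>. That these functions
  are differentiable rests on the second derivatives of the curve and of the normal field
  along it (\<open>differentiable_deriv_on_compose\<close>).
\<close>

section \<open>Differentiability of the geodesic curvature and torsion\<close>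

text \<open>
  A map that is smooth on \<open>M\<close> has local smooth extensions \<open>h\<close> to open sets only, so the
  chain rule is available only near the given parameter. There the derivative of
  \<open>N \<circ> \<gamma>\<close> is the sum over the basis vectors \<open>b\<close> of the components of \<open>\<gamma>'\<close> times the
  partial derivatives of \<open>h\<close> along \<open>\<gamma>\<close>, and each of these factors is differentiable
  once more.
\<close>

lemma differentiable_deriv_on_compose:
  fixes N :: "'a::euclidean_space \<Rightarrow> 'b::euclidean_space" and \<gamma> :: "real \<Rightarrow> 'a"
  assumes I: "is_interval I" "interior I \<noteq> {}"
    and \<gamma>: "smooth_map_on \<gamma> I" "\<gamma> ` I \<subseteq> M"
    and N: "smooth_map_on N M" and s: "s \<in> I"
  shows "deriv_on I (\<lambda>t. N (\<gamma> t)) differentiable (at s within I)"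
proof -
  have \<gamma>1: "(\<gamma> has_vector_derivative deriv_on I \<gamma> y) (at y within I)" if "y \<in> I" for y
    by (rule smooth_map_on_has_vector_derivative[OF I \<gamma>(1) that])
  have \<gamma>2: "(deriv_on I \<gamma> has_vector_derivative deriv_on I (deriv_on I \<gamma>) s) (at s within I)"
    by (rule smooth_map_on_has_vector_derivative[OF I smooth_map_on_deriv_on[OF I \<gamma>(1)] s])
  have "\<gamma> s \<in> M"
    using \<gamma>(2) s by auto
  then obtain W h where W: "\<gamma> s \<in> W" "smooth_on_open h W" "\<And>y. y \<in> W \<inter> M \<Longrightarrow> h y = N y"
    using N unfolding smooth_map_on_def by meson
  have opW: "open W"
    using W(2) by (simp add: smooth_on_open_def)
  let ?D = "\<lambda>y. \<Sum>b\<in>Basis. (deriv_on I \<gamma> y \<bullet> b) *\<^sub>R frechet_derivative h (at (\<gamma> y)) b"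
  have D: "deriv_on I (\<lambda>t. N (\<gamma> t)) y = ?D y" if y: "y \<in> I" "\<gamma> y \<in> W" for y
  proof -
    have h: "(h has_derivative frechet_derivative h (at (\<gamma> y))) (at (\<gamma> y))"
      using smooth_on_open_differentiable[OF W(2) y(2)] frechet_derivative_works by blast
    have c: "((h \<circ> \<gamma>) has_vector_derivative frechet_derivative h (at (\<gamma> y)) (deriv_on I \<gamma> y))
        (at y within I)"
      by (rule vector_derivative_diff_chain_within[OF \<gamma>1[OF y(1)] has_derivative_at_withinI[OF h]])
    have "(\<gamma> \<longlongrightarrow> \<gamma> y) (at y within I)"
      using has_vector_derivative_continuous[OF \<gamma>1[OF y(1)]] by (simp add: continuous_within)
    then have "eventually (\<lambda>t. \<gamma> t \<in> W) (at y within I)"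
      using y(2) opW topological_tendstoD by blast
    moreover have "eventually (\<lambda>t. t \<in> I) (at y within I)"
      by (simp add: eventually_at_filter)
    ultimately have ev: "eventually (\<lambda>t. (h \<circ> \<gamma>) t = N (\<gamma> t)) (at y within I)"
      by eventually_elim (use W(3) \<gamma>(2) in auto)
    have "(h \<circ> \<gamma>) y = N (\<gamma> y)"
      using W(3) y \<gamma>(2) by auto
    then have d: "((\<lambda>t. N (\<gamma> t)) has_vector_derivative
        frechet_derivative h (at (\<gamma> y)) (deriv_on I \<gamma> y)) (at y within I)"
      using y(1) unfolding has_vector_derivative_def
      by (rule has_derivative_transform_eventually[OF c[unfolded has_vector_derivative_def] ev])
    have "frechet_derivative h (at (\<gamma> y)) (deriv_on I \<gamma> y)
        = frechet_derivative h (at (\<gamma> y)) (\<Sum>b\<in>Basis. (deriv_on I \<gamma> y \<bullet> b) *\<^sub>R b)"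
      by (simp only: euclidean_representation)
    also have "\<dots> = ?D y"
      using has_derivative_linear[OF h] by (simp only: linear_sum linear_scale)
    finally have "frechet_derivative h (at (\<gamma> y)) (deriv_on I \<gamma> y) = ?D y" .
    then show ?thesis
      using deriv_on_eq[OF I y(1) d] by simp
  qed
  have "(\<lambda>y. frechet_derivative h (at (\<gamma> y)) b) differentiable (at s within I)" for b
  proof -
    let ?k = "\<lambda>x. frechet_derivative h (at x) b"
    have "?k differentiable (at (\<gamma> s))"
      by (rule smooth_on_open_differentiable[OF smooth_on_open_frechet_derivative[OF W(2)] W(1)])
    then have "?k differentiable (at (\<gamma> s) within \<gamma> ` I)"
      by (rule differentiable_at_withinI)
    moreover have "\<gamma> differentiable (at s within I)"
      by (rule differentiableI_vector[OF \<gamma>1[OF s]])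
    ultimately show ?thesis
      using differentiable_chain_within[of \<gamma> s I ?k] by (simp add: o_def)
  qed
  moreover have "(\<lambda>y. deriv_on I \<gamma> y \<bullet> b) differentiable (at s within I)" for b
    using differentiableI_vector[OF \<gamma>2] by simp
  ultimately have Dd: "?D differentiable (at s within I)"
    by (intro differentiable_sum differentiable_scaleR) auto
  have "(\<gamma> \<longlongrightarrow> \<gamma> s) (at s within I)"
    using has_vector_derivative_continuous[OF \<gamma>1[OF s]] by (simp add: continuous_within)
  then have "eventually (\<lambda>t. \<gamma> t \<in> W) (at s within I)"
    using W(1) opW topological_tendstoD by blast
  moreover have "eventually (\<lambda>t. t \<in> I) (at s within I)"
    by (simp add: eventually_at_filter)
  ultimately have "eventually (\<lambda>t. ?D t = deriv_on I (\<lambda>t. N (\<gamma> t)) t) (at s within I)"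
    by eventually_elim (use D in auto)
  moreover obtain D' where "(?D has_derivative D') (at s within I)"
    using Dd unfolding differentiable_def by blast
  ultimately show ?thesis
    using has_derivative_transform_eventually[of ?D D' s I "deriv_on I (\<lambda>t. N (\<gamma> t))"]
      D[OF s W(1)] s unfolding differentiable_def by auto
qed

text \<open>
  The torsion \<open>V' \<bullet> U\<close> equals \<open>- U' \<bullet> V\<close>. The second form is the one to differentiate:
  \<open>U'\<close> is the derivative of the normal field along \<open>\<gamma>\<close>, whereas \<open>V = U \<times> T\<close> would
  require the product rule before a second differentiation.
\<close>

lemma darboux_curvatures_have_derivative:
  fixes N :: "real^3 \<Rightarrow> real^3" and \<gamma> :: "real \<Rightarrow> real^3"
  assumes M: "oriented_surface M N" and I: "is_interval I" "interior I \<noteq> {}"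
    and \<gamma>: "unit_speed_curve_on M I \<gamma>" and s: "s \<in> I"
  shows "(geodesic_curvature N I \<gamma> has_vector_derivative
            deriv_on I (geodesic_curvature N I \<gamma>) s) (at s within I)" (is ?g)
    and "(geodesic_torsion N I \<gamma> has_vector_derivative
            deriv_on I (geodesic_torsion N I \<gamma>) s) (at s within I)" (is ?t)
proof -
  have sm: "smooth_map_on \<gamma> I" "\<gamma> ` I \<subseteq> M" "smooth_map_on N M"
    using \<gamma> M by (auto simp: unit_speed_curve_on_def oriented_surface_def)
  have V: "darboux_V N I \<gamma> differentiable (at s within I)"
    by (rule differentiableI_vector[OF darboux_has_vector_derivative(3)[OF M I \<gamma> s]])
  have "smooth_map_on (deriv_on I (darboux_T I \<gamma>)) I"
    unfolding darboux_T_def by (intro smooth_map_on_deriv_on I sm)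
  then have "deriv_on I (darboux_T I \<gamma>) differentiable (at s within I)"
    using smooth_map_on_has_vector_derivative[OF I _ s] differentiableI_vector by blast
  then have "(\<lambda>y. deriv_on I (darboux_T I \<gamma>) y \<bullet> darboux_V N I \<gamma> y) differentiable (at s within I)"
    using V by (rule differentiable_inner)
  then have "geodesic_curvature N I \<gamma> differentiable (at s within I)"
    by (simp add: geodesic_curvature_def[abs_def])
  then obtain g' where "(geodesic_curvature N I \<gamma> has_vector_derivative g') (at s within I)"
    unfolding vector_derivative_works has_vector_derivative_def by blast
  then show ?g
    using deriv_on_eq[OF I s] by metis
  have U: "darboux_U N \<gamma> = (\<lambda>t. N (\<gamma> t))"
    by (auto simp: darboux_U_def)
  have "deriv_on I (darboux_U N \<gamma>) differentiable (at s within I)"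
    unfolding U by (rule differentiable_deriv_on_compose[OF I sm s])
  then obtain Q where Q:
    "((\<lambda>y. - (deriv_on I (darboux_U N \<gamma>) y \<bullet> darboux_V N I \<gamma> y)) has_derivative Q) (at s within I)"
    using V differentiable_minus[OF differentiable_inner] unfolding differentiable_def by blast
  have "geodesic_torsion N I \<gamma> y = - (deriv_on I (darboux_U N \<gamma>) y \<bullet> darboux_V N I \<gamma> y)"
    if "y \<in> I" for y
  proof -
    note on = darboux_orthonormal[OF M I \<gamma> that]
    note fr = orthonormal_cross_expansion(1-3)[OF on, folded darboux_V_def]
    show ?thesis
      using fr by (simp add: darboux_equations(3)[OF M I \<gamma> that] inner_diff_left
          inner_commute[of "darboux_T I \<gamma> y"] dot_square_norm)
  qed
  then have "(geodesic_torsion N I \<gamma> has_derivative Q) (at s within I)"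
    using has_derivative_transform[OF s _ Q] by blast
  then have "geodesic_torsion N I \<gamma> differentiable (at s within I)"
    unfolding differentiable_def by blast
  then obtain t' where "(geodesic_torsion N I \<gamma> has_vector_derivative t') (at s within I)"
    unfolding vector_derivative_works by blast
  then show ?t
    using deriv_on_eq[OF I s] by metis
qed

section \<open>Lancret's theorem for a Frenet-type frame\<close>

text \<open>
  The coefficient functions are arbitrary: the argument only differentiates inner products of
  the frame vectors with the axis, so \<open>\<rho>\<close> and \<open>\<sigma>\<close> themselves are never differentiated.
  The last hypothesis says that the frame spans, and serves to exclude that the axis is
  orthogonal to all three vectors.
\<close>

theorem lancret_frame:
  fixes X P W :: "real \<Rightarrow> 'a::euclidean_space" and \<rho> \<sigma> :: "real \<Rightarrow> real"
  assumes I: "convex I" "I \<noteq> {}"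
    and X: "\<And>s. s \<in> I \<Longrightarrow> (X has_vector_derivative \<rho> s *\<^sub>R P s) (at s within I)"
    and P: "\<And>s. s \<in> I \<Longrightarrow>
          (P has_vector_derivative \<rho> s *\<^sub>R (\<sigma> s *\<^sub>R W s - X s)) (at s within I)"
    and W: "\<And>s. s \<in> I \<Longrightarrow> (W has_vector_derivative - (\<rho> s * \<sigma> s) *\<^sub>R P s) (at s within I)"
    and \<rho>: "\<And>s. s \<in> I \<Longrightarrow> \<rho> s \<noteq> 0"
    and nt: "\<And>s. s \<in> I \<Longrightarrow> at s within I \<noteq> bot"
    and on: "\<And>s. s \<in> I \<Longrightarrow> norm (X s) = 1" "\<And>s. s \<in> I \<Longrightarrow> norm (W s) = 1"
      "\<And>s. s \<in> I \<Longrightarrow> X s \<bullet> W s = 0"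
    and total: "\<And>s d. s \<in> I \<Longrightarrow> X s \<bullet> d = 0 \<Longrightarrow> P s \<bullet> d = 0 \<Longrightarrow> W s \<bullet> d = 0 \<Longrightarrow> d = 0"
  shows "(\<exists>d \<theta>. norm d = 1 \<and> (\<forall>s\<in>I. X s \<bullet> d = cos \<theta>)) \<longleftrightarrow> \<sigma> constant_on I"
proof
  assume "\<exists>d \<theta>. norm d = 1 \<and> (\<forall>s\<in>I. X s \<bullet> d = cos \<theta>)"
  then obtain d c where d: "norm d = 1" "\<And>s. s \<in> I \<Longrightarrow> X s \<bullet> d = c"
    by blast
  have inner_d: "((\<lambda>t. Y t \<bullet> d) has_vector_derivative Y' \<bullet> d) (at s within I)"
    if "(Y has_vector_derivative Y') (at s within I)" for Y Y' s
    by (rule bounded_linear.has_vector_derivative[OF bounded_linear_inner_left that])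
  have zero: "y' = 0" if "s \<in> I" "(f has_vector_derivative y') (at s within I)"
      "\<And>t. t \<in> I \<Longrightarrow> f t = k" for s y' k and f :: "real \<Rightarrow> real"
  proof -
    have "(f has_vector_derivative 0) (at s within I)"
      by (rule has_vector_derivative_transform[OF that(1) _ has_vector_derivative_const[of k]])
         (use that(3) in auto)
    then show ?thesis
      using vector_derivative_unique_within[OF nt[OF that(1)] that(2)] by blast
  qed
  have Pd: "P s \<bullet> d = 0" if "s \<in> I" for s
    using zero[OF that inner_d[OF X[OF that]] d(2)] \<rho>[OF that] by simp
  have rel: "\<sigma> s * (W s \<bullet> d) = c" if "s \<in> I" for s
    using zero[OF that inner_d[OF P[OF that]] Pd] \<rho>[OF that] d(2)[OF that]
    by (simp add: inner_diff_left)
  have "((\<lambda>t. W t \<bullet> d) has_vector_derivative 0) (at s within I)" if "s \<in> I" for s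
    using inner_d[OF W[OF that]] Pd[OF that] by simp
  then obtain m where m: "\<And>s. s \<in> I \<Longrightarrow> W s \<bullet> d = m"
    using has_vector_derivative_zero_constant[OF I(1), of "\<lambda>t. W t \<bullet> d"] by blast
  \<comment> \<open>With \<open>m = 0\<close> also \<open>c = \<sigma> m = 0\<close>, and \<open>d\<close> would be orthogonal to the whole frame.\<close>
  have "m \<noteq> 0"
  proof
    assume "m = 0"
    obtain s where s: "s \<in> I"
      using I(2) by blast
    have "d = 0"
      using total[OF s] Pd[OF s] d(2)[OF s] m[OF s] rel[OF s] \<open>m = 0\<close> by simp
    with d(1) show False
      by simp
  qed
  then have "\<sigma> s = c / m" if "s \<in> I" for s
    using rel[OF that] m[OF that] by (simp add: field_simps)
  then show "\<sigma> constant_on I"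
    unfolding constant_on_def by blast
next
  assume "\<sigma> constant_on I"
  then obtain c where c: "\<And>s. s \<in> I \<Longrightarrow> \<sigma> s = c"
    unfolding constant_on_def by blast
  \<comment> \<open>The Darboux vector of the frame, divided by \<open>\<rho>\<close>, is the axis.\<close>
  have "((\<lambda>t. c *\<^sub>R X t + W t) has_vector_derivative 0) (at s within I)" if "s \<in> I" for s
    using has_vector_derivative_add[OF
        bounded_linear.has_vector_derivative[OF bounded_linear_scaleR_right X[OF that]] W[OF that], of c]
      c[OF that] by (simp add: mult.commute)
  then obtain a where a: "\<And>s. s \<in> I \<Longrightarrow> c *\<^sub>R X s + W s = a"
    using has_vector_derivative_zero_constant[OF I(1), of "\<lambda>t. c *\<^sub>R X t + W t"] by blast
  have sq: "X s \<bullet> X s = 1" "W s \<bullet> W s = 1" "X s \<bullet> W s = 0" "W s \<bullet> X s = 0" if "s \<in> I" for s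
    using on[OF that] by (simp_all add: dot_square_norm inner_commute)
  have Xa: "X s \<bullet> a = c" if "s \<in> I" for s
    using sq[OF that] by (simp add: a[OF that, symmetric] inner_add_right)
  obtain s where s: "s \<in> I"
    using I(2) by blast
  have "W s \<bullet> a = 1"
    using sq[OF s] by (simp add: a[OF s, symmetric] inner_add_right)
  then have "a \<noteq> 0"
    by auto
  then have na: "norm (a /\<^sub>R norm a) = 1"
    by simp
  have "\<bar>X s \<bullet> (a /\<^sub>R norm a)\<bar> \<le> 1"
    using Cauchy_Schwarz_ineq2[of "X s" "a /\<^sub>R norm a"] na on(1)[OF s] by simp
  then have "\<bar>c / norm a\<bar> \<le> 1"
    using Xa[OF s] by (simp add: divide_inverse mult.commute)
  then have "cos (arccos (c / norm a)) = c / norm a"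
    by (rule cos_arccos_abs)
  then have "X t \<bullet> (a /\<^sub>R norm a) = cos (arccos (c / norm a))" if "t \<in> I" for t
    using Xa[OF that] by (simp add: divide_inverse mult.commute)
  with na show "\<exists>d \<theta>. norm d = 1 \<and> (\<forall>s\<in>I. X s \<bullet> d = cos \<theta>)"
    by blast
qed

section \<open>The Frenet-type frame along V\<close>

text \<open>
  A point moving on the unit circle has velocity \<open>\<omega>\<close> times its rotation by a right angle;
  here \<open>\<omega>\<close> is the derivative of the polar angle of \<open>(f, g)\<close>, written without choosing
  an angle function.
\<close>

lemma has_field_derivative_normalize_pair:
  fixes f g :: "real \<Rightarrow> real"
  assumes f: "(f has_real_derivative f') (at s within I)"
    and g: "(g has_real_derivative g') (at s within I)"
    and nz: "(f s)\<^sup>2 + (g s)\<^sup>2 \<noteq> 0"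
  defines "r \<equiv> \<lambda>s. sqrt ((f s)\<^sup>2 + (g s)\<^sup>2)"
  defines "\<omega> \<equiv> (g' * f s - f' * g s) / (r s)\<^sup>2"
  shows "((\<lambda>s. f s / r s) has_real_derivative - (g s / r s * \<omega>)) (at s within I)"
    and "((\<lambda>s. g s / r s) has_real_derivative f s / r s * \<omega>) (at s within I)"
proof -
  have pos: "(f s)\<^sup>2 + (g s)\<^sup>2 > 0"
    using nz by (metis less_eq_real_def sum_power2_ge_zero)
  have r: "r s > 0" "(r s)\<^sup>2 = (f s)\<^sup>2 + (g s)\<^sup>2"
    using pos by (auto simp: r_def)
  have dr: "(r has_real_derivative (f s * f' + g s * g') / r s) (at s within I)"
  proof -
    have "((\<lambda>s. (f s)\<^sup>2 + (g s)\<^sup>2) has_real_derivative 2 * (f s * f' + g s * g')) (at s within I)"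
      by (auto intro!: derivative_eq_intros f g simp: algebra_simps)
    then have "(r has_real_derivative inverse (r s) / 2 * (2 * (f s * f' + g s * g'))) (at s within I)"
      unfolding r_def
      by (rule DERIV_chain2[where f = sqrt and g = "\<lambda>s. (f s)\<^sup>2 + (g s)\<^sup>2",
            OF DERIV_real_sqrt[OF pos]])
    moreover have "inverse a / 2 * (2 * b) = b / a" for a b :: real
      by (simp add: field_simps)
    ultimately show ?thesis
      by (simp only:)
  qed
  have "((\<lambda>s. f s / r s) has_real_derivative
      (f' * r s - f s * ((f s * f' + g s * g') / r s)) / (r s * r s)) (at s within I)"
    using r by (intro DERIV_divide f dr) auto
  moreover have "(f' * r s - f s * ((f s * f' + g s * g') / r s)) / (r s * r s)
      = (f' * (r s)\<^sup>2 - f s * (f s * f' + g s * g')) / (r s)^3"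
    using r(1) by (simp add: field_simps power2_eq_square power3_eq_cube)
  moreover have "f' * (r s)\<^sup>2 - f s * (f s * f' + g s * g') = - (g s * (g' * f s - f' * g s))"
    unfolding r(2) by (simp add: algebra_simps power2_eq_square)
  moreover have "- (g s * (g' * f s - f' * g s)) / (r s)^3 = - (g s / r s * \<omega>)"
    by (simp add: \<omega>_def power2_eq_square power3_eq_cube)
  ultimately show "((\<lambda>s. f s / r s) has_real_derivative - (g s / r s * \<omega>)) (at s within I)"
    by (simp only:)
  have "((\<lambda>s. g s / r s) has_real_derivative
      (g' * r s - g s * ((f s * f' + g s * g') / r s)) / (r s * r s)) (at s within I)"
    using r by (intro DERIV_divide g dr) auto
  moreover have "(g' * r s - g s * ((f s * f' + g s * g') / r s)) / (r s * r s)
      = (g' * (r s)\<^sup>2 - g s * (f s * f' + g s * g')) / (r s)^3"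
    using r(1) by (simp add: field_simps power2_eq_square power3_eq_cube)
  moreover have "g' * (r s)\<^sup>2 - g s * (f s * f' + g s * g') = f s * (g' * f s - f' * g s)"
    unfolding r(2) by (simp add: algebra_simps power2_eq_square)
  moreover have "f s * (g' * f s - f' * g s) / (r s)^3 = f s / r s * \<omega>"
    by (simp add: \<omega>_def power2_eq_square power3_eq_cube)
  ultimately show "((\<lambda>s. g s / r s) has_real_derivative f s / r s * \<omega>) (at s within I)"
    by (simp only:)
qed

theorem theorem2:
  fixes M :: "(real^3) set" and N :: "real^3 \<Rightarrow> real^3"
    and I :: "real set" and \<gamma> :: "real \<Rightarrow> real^3"
  assumes "oriented_surface M N"
    and "is_interval I" and "interior I \<noteq> {}"
    and "unit_speed_curve_on M I \<gamma>"
    and "\<And>s. s \<in> I \<Longrightarrow> (geodesic_torsion N I \<gamma> s, geodesic_curvature N I \<gamma> s) \<noteq> (0, 0)"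
  shows "relatively_normal_slant_helix N I \<gamma> \<longleftrightarrow> sigma_v N I \<gamma> constant_on I"
proof -
  note A = assms(1-4)
  define T V U where "T = darboux_T I \<gamma>" and "V = darboux_V N I \<gamma>" and "U = darboux_U N \<gamma>"
  define f n t where "f = geodesic_curvature N I \<gamma>" and "n = normal_curvature N I \<gamma>"
    and "t = geodesic_torsion N I \<gamma>"
  define f' t' where "f' = deriv_on I f" and "t' = deriv_on I t"
  \<comment> \<open>\<open>(p, q)\<close> is the direction of \<open>(\<kappa>g, \<tau>g)\<close>, and \<open>\<omega>\<close> its angular velocity.\<close>
  define r where "r = (\<lambda>s. sqrt ((f s)\<^sup>2 + (t s)\<^sup>2))"
  define p q where "p = (\<lambda>s. f s / r s)" and "q = (\<lambda>s. t s / r s)"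
  define \<omega> where "\<omega> = (\<lambda>s. (t' s * f s - f' s * t s) / (r s)\<^sup>2)"
  define \<sigma> where "\<sigma> = sigma_v N I \<gamma>"
  define P W where "P = (\<lambda>s. - p s *\<^sub>R T s + q s *\<^sub>R U s)"
    and "W = (\<lambda>s. q s *\<^sub>R T s + p s *\<^sub>R U s)"
  have nz: "(f s)\<^sup>2 + (t s)\<^sup>2 \<noteq> 0" if "s \<in> I" for s
    using assms(5)[OF that] by (auto simp: f_def t_def sum_power2_eq_zero_iff)
  have r: "r s > 0" "(r s)\<^sup>2 = (f s)\<^sup>2 + (t s)\<^sup>2" if "s \<in> I" for s
    using nz[OF that] by (auto simp: r_def sum_power2_gt_zero_iff)
  have fpq: "f s = r s * p s" "t s = r s * q s" "(p s)\<^sup>2 + (q s)\<^sup>2 = 1" if "s \<in> I" for s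
  proof -
    show "f s = r s * p s" "t s = r s * q s"
      using r(1)[OF that] by (simp_all add: p_def q_def)
    show "(p s)\<^sup>2 + (q s)\<^sup>2 = 1"
      using r[OF that] nz[OF that]
      by (simp add: p_def q_def power_divide add_divide_distrib[symmetric])
  qed
  have \<sigma>: "r s * \<sigma> s = \<omega> s - n s" if "s \<in> I" for s
  proof -
    have "((f s)\<^sup>2 + (t s)\<^sup>2) powr (3/2) = (r s powr 2) powr (3/2)"
      using r[OF that] by simp
    also have "\<dots> = (r s) ^ 3"
      unfolding powr_powr using r(1)[OF that] by simp
    finally have "\<sigma> s = (t' s * f s - f' s * t s - n s * (r s)\<^sup>2) / (r s)^3"
      unfolding \<sigma>_def sigma_v_def f_def[symmetric] n_def[symmetric] t_def[symmetric] Let_def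
        f'_def[symmetric] t'_def[symmetric] by (simp add: r(2)[OF that])
    then show ?thesis
      using r(1)[OF that] by (simp add: \<omega>_def field_simps power2_eq_square power3_eq_cube)
  qed
  have dp: "(p has_real_derivative - (q s * \<omega> s)) (at s within I)"
    and dq: "(q has_real_derivative p s * \<omega> s) (at s within I)" if "s \<in> I" for s
  proof -
    have "(f has_real_derivative f' s) (at s within I)" "(t has_real_derivative t' s) (at s within I)"
      using darboux_curvatures_have_derivative[OF A that]
      by (simp_all add: has_real_derivative_iff_has_vector_derivative f_def t_def f'_def t'_def)
    from has_field_derivative_normalize_pair[OF this nz[OF that]]
    show "(p has_real_derivative - (q s * \<omega> s)) (at s within I)"
      "(q has_real_derivative p s * \<omega> s) (at s within I)"
      by (simp_all add: p_def q_def r_def \<omega>_def)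
  qed
  have dT: "(T has_vector_derivative f s *\<^sub>R V s + n s *\<^sub>R U s) (at s within I)"
    and dV: "(V has_vector_derivative - f s *\<^sub>R T s + t s *\<^sub>R U s) (at s within I)"
    and dU: "(U has_vector_derivative - n s *\<^sub>R T s - t s *\<^sub>R V s) (at s within I)"
    if "s \<in> I" for s
    using darboux_has_vector_derivative[OF A that] darboux_equations[OF A that]
    by (simp_all add: T_def V_def U_def f_def n_def t_def)
  have fr: "norm (T s) = 1" "norm (U s) = 1" "U s \<bullet> T s = 0" "norm (V s) = 1"
    "V s \<bullet> T s = 0" "V s \<bullet> U s = 0"
    "\<And>x. x = (x \<bullet> T s) *\<^sub>R T s + (x \<bullet> V s) *\<^sub>R V s + (x \<bullet> U s) *\<^sub>R U s" if "s \<in> I" for s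
  proof -
    note on = darboux_orthonormal[OF A that]
    note fr = orthonormal_cross_expansion[OF on, folded darboux_V_def]
    show "norm (T s) = 1" "norm (U s) = 1" "U s \<bullet> T s = 0" "norm (V s) = 1"
      "V s \<bullet> T s = 0" "V s \<bullet> U s = 0"
      "\<And>x. x = (x \<bullet> T s) *\<^sub>R T s + (x \<bullet> V s) *\<^sub>R V s + (x \<bullet> U s) *\<^sub>R U s"
      using on fr unfolding T_def U_def V_def by blast+
  qed
  have V': "(V has_vector_derivative r s *\<^sub>R P s) (at s within I)" if "s \<in> I" for s
    using dV[OF that] fpq(1,2)[OF that] by (simp add: P_def algebra_simps)
  have P': "(P has_vector_derivative r s *\<^sub>R (\<sigma> s *\<^sub>R W s - V s)) (at s within I)" if "s \<in> I" for s
  proof -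
    have "(P has_vector_derivative
        (- p s *\<^sub>R (f s *\<^sub>R V s + n s *\<^sub>R U s) + (q s * \<omega> s) *\<^sub>R T s)
        + (q s *\<^sub>R (- n s *\<^sub>R T s - t s *\<^sub>R V s) + (p s * \<omega> s) *\<^sub>R U s)) (at s within I)"
      unfolding P_def
      using DERIV_minus[OF dp[OF that]]
      by (intro has_vector_derivative_add has_vector_derivative_scaleR dT dU dq that) simp_all
    moreover have "(- p s *\<^sub>R (f s *\<^sub>R V s + n s *\<^sub>R U s) + (q s * \<omega> s) *\<^sub>R T s)
        + (q s *\<^sub>R (- n s *\<^sub>R T s - t s *\<^sub>R V s) + (p s * \<omega> s) *\<^sub>R U s)
        = (\<omega> s - n s) *\<^sub>R W s - (r s * ((p s)\<^sup>2 + (q s)\<^sup>2)) *\<^sub>R V s"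
      unfolding fpq(1,2)[OF that] W_def by (simp add: algebra_simps power2_eq_square)
    moreover have "\<dots> = r s *\<^sub>R (\<sigma> s *\<^sub>R W s - V s)"
      unfolding fpq(3)[OF that] \<sigma>[OF that, symmetric] by (simp add: scaleR_diff_right)
    ultimately show ?thesis
      by (simp only:)
  qed
  have W': "(W has_vector_derivative - (r s * \<sigma> s) *\<^sub>R P s) (at s within I)" if "s \<in> I" for s
  proof -
    have "(W has_vector_derivative
        (q s *\<^sub>R (f s *\<^sub>R V s + n s *\<^sub>R U s) + (p s * \<omega> s) *\<^sub>R T s)
        + (p s *\<^sub>R (- n s *\<^sub>R T s - t s *\<^sub>R V s) + (- (q s * \<omega> s)) *\<^sub>R U s)) (at s within I)"
      unfolding W_def
      by (intro has_vector_derivative_add has_vector_derivative_scaleR dT dU dq dp that)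
    moreover have "(q s *\<^sub>R (f s *\<^sub>R V s + n s *\<^sub>R U s) + (p s * \<omega> s) *\<^sub>R T s)
        + (p s *\<^sub>R (- n s *\<^sub>R T s - t s *\<^sub>R V s) + (- (q s * \<omega> s)) *\<^sub>R U s)
        = - (\<omega> s - n s) *\<^sub>R P s"
      unfolding fpq(1,2)[OF that] P_def by (simp add: algebra_simps)
    ultimately show ?thesis
      by (simp add: \<sigma>[OF that])
  qed
  have nW: "norm (W s) = 1" if "s \<in> I" for s
  proof -
    have "W s \<bullet> W s = (p s)\<^sup>2 + (q s)\<^sup>2"
      using fr(1-3)[OF that]
      by (simp add: W_def inner_add_left inner_add_right norm_eq_1 inner_commute
          power2_eq_square)
    then show ?thesis
      using fpq(3)[OF that] by (simp add: norm_eq_sqrt_inner)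
  qed
  have VW: "V s \<bullet> W s = 0" if "s \<in> I" for s
    using fr(5,6)[OF that] by (simp add: W_def inner_add_right)
  \<comment> \<open>\<open>P, W\<close> arise from \<open>T, U\<close> by an orthogonal matrix; inverting it recovers \<open>T, U\<close>.\<close>
  have total: "d = 0" if s: "s \<in> I" and d: "V s \<bullet> d = 0" "P s \<bullet> d = 0" "W s \<bullet> d = 0" for s d
  proof -
    have "q s *\<^sub>R W s - p s *\<^sub>R P s = ((p s)\<^sup>2 + (q s)\<^sup>2) *\<^sub>R T s"
      and "p s *\<^sub>R W s + q s *\<^sub>R P s = ((p s)\<^sup>2 + (q s)\<^sup>2) *\<^sub>R U s"
      by (simp_all add: P_def W_def algebra_simps power2_eq_square)
    then have "T s = q s *\<^sub>R W s - p s *\<^sub>R P s" "U s = p s *\<^sub>R W s + q s *\<^sub>R P s"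
      unfolding fpq(3)[OF s] by simp_all
    then have "d \<bullet> T s = 0" "d \<bullet> U s = 0" "d \<bullet> V s = 0"
      using d by (simp_all add: inner_diff_right inner_add_right inner_commute[of d])
    then show ?thesis
      by (subst fr(7)[OF s]) simp
  qed
  have "(\<exists>d \<theta>. norm d = 1 \<and> (\<forall>s\<in>I. V s \<bullet> d = cos \<theta>)) \<longleftrightarrow> \<sigma> constant_on I"
  proof (rule lancret_frame[OF _ _ V' P' W' _ _ fr(4) nW VW total])
    show "convex I"
      using assms(2) by (rule is_interval_convex)
    show "I \<noteq> {}"
      using assms(3) by auto
    show "r s \<noteq> 0" if "s \<in> I" for s
      using r(1)[OF that] by simp
    show "at s within I \<noteq> bot" if "s \<in> I" for s
      by (rule at_within_interval_nontrivial[OF assms(2,3) that])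
  qed
  then show ?thesis
    unfolding relatively_normal_slant_helix_def V_def \<sigma>_def .
qed

end
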